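(* Let $a,b\in\mathbb{N}$ with $a$ odd and $b=a-1$, and let $n_k=ai+b$ denote the general term of $S(a,b)$. After applying the transformation $T_2$ to $S(a,b)$ and then the odd compact Collatz step $n\mapsto\frac{3n+1}{2}$ to each term, one obtains a progression with general term $n_{k+1}=a'j+b'$, where $a'$ is odd and $b'=a'-1$.
   Context: $\mathbb{N}=\{0,1,2,\dots\}$. $S(a,b)$ denotes the sequence $(ai+b)_{i\in\mathbb{N}}$. The transformation $T_2$ is the index substitution $i\mapsto 2j+1$, acting on sequences by $T_2:S(a,b)\mapsto S(2a,b+a)=(2aj+a+b)_{j\in\mathbb{N}}$. The compact Collatz step is $n\mapsto n/2$ for $n$ even and $n\mapsto(3n+1)/2$ for $n$ odd (the latter being the odd step). *)

theory Defs
  imports Main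
begin

definition S :: "nat \<Rightarrow> nat \<Rightarrow> nat \<Rightarrow> nat" where
  "S a b = (\<lambda>i. a * i + b)"

definition T2 :: "(nat \<Rightarrow> nat) \<Rightarrow> nat \<Rightarrow> nat" where
  "T2 s = (\<lambda>j. s (2 * j + 1))"

lemma T2_S: "T2 (S a b) = S (2 * a) (b + a)"
  by (auto simp: T2_def S_def fun_eq_iff algebra_simps)

(* The odd step of the compact Collatz map. The division truncates, so this is
   n |-> (3n+1)/2 only for odd n. *)
definition collatz_odd_step :: "nat \<Rightarrow> nat" where
  "collatz_odd_step n = (3 * n + 1) div 2"

lemma collatz_odd_step_exact: "odd n \<Longrightarrow> 2 * collatz_odd_step n = 3 * n + 1"
  by (simp add: collatz_odd_step_def)

end

theory Submission
  imports Defs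
begin

text \<open>
  The condition \<open>b = a - 1\<close> says that the term with index \<open>i\<close> is one less than \<open>a * (i + 1)\<close>.
  In the shifted coordinate \<open>n + 1\<close> the progression is therefore purely multiplicative:
  \<open>T2\<close> replaces \<open>i + 1\<close> by \<open>2 * (j + 1)\<close>, and since \<open>(3 * n + 1) / 2 + 1 = 3 * (n + 1) / 2\<close>,
  the odd step multiplies by \<open>3 / 2\<close>. Together they turn \<open>a * (i + 1)\<close> into \<open>3 * a * (j + 1)\<close>,
  so that \<open>a' = 3 * a\<close>, which is odd with \<open>a\<close>.
\<close>

text \<open>
  Adding one on the left keeps the truncated subtraction \<open>a - 1\<close> out of the later arithmetic.
\<close>
lemma Suc_S_pred:
  assumes "0 < a"
  shows "Suc (S a (a - 1) i) = a * (i + 1)"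
  using assms by (simp add: S_def)

lemma Suc_T2_S_pred:
  assumes "0 < a"
  shows "Suc (T2 (S a (a - 1)) j) = 2 * (a * (j + 1))"
  using Suc_S_pred[OF assms, of "2 * j + 1"] by (simp add: T2_def algebra_simps)

lemma Suc_collatz_odd_step:
  assumes "Suc n = 2 * m"
  shows "Suc (collatz_odd_step n) = 3 * m"
  using assms unfolding collatz_odd_step_def by presburger

theorem lemma7p1:
  fixes a b :: nat
  assumes "odd a" and "b = a - 1"
  shows "(\<forall>j. odd (T2 (S a b) j)) \<and>
    (\<exists>a' b'. odd a' \<and> b' = a' - 1 \<and>
       (\<forall>j. collatz_odd_step (T2 (S a b) j) = S a' b' j))"
proof (intro conjI allI exI)
  have a: "0 < a" using assms(1) by (rule odd_pos)
  have term_eq: "Suc (T2 (S a b) j) = 2 * (a * (j + 1))" for j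
    using Suc_T2_S_pred[OF a] assms(2) by simp
  show "odd (T2 (S a b) j)" for j
    by (metis dvd_triv_left even_Suc term_eq)
  show "odd (3 * a)" using assms(1) by simp
  show "3 * a - 1 = 3 * a - 1" ..
  show "collatz_odd_step (T2 (S a b) j) = S (3 * a) (3 * a - 1) j" for j
  proof -
    have "Suc (collatz_odd_step (T2 (S a b) j)) = 3 * (a * (j + 1))"
      using term_eq by (rule Suc_collatz_odd_step)
    also have "\<dots> = Suc (S (3 * a) (3 * a - 1) j)"
      using Suc_S_pred[of "3 * a" j] a by (simp add: mult.assoc)
    finally show ?thesis by simp
  qed
qed

end
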